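(* Assume $\Omega\ne0$. Let $a\in\mathbb R$, let $\mathbf x:\mathbb R\to\mathbb S^2$ and $\mathbf X_0:\mathbb R\to\mathbb R^3$ be smooth with $\mathbf X_0'=\mathbf x$, and suppose that for a constant vector $\mathbf d\in\mathbb R^3$ $$\mathbf x\times\mathbf x'-\Omega e_3\times\mathbf X_0+a\mathbf x=\mathbf d.$$ Up to replacing $\mathbf X_0$ by $\widetilde{\mathbf X}_0=\mathbf X_0+\mathbf c$ for some $\mathbf c\in\mathbb R^3$, one may suppose that the constant vector $\mathbf d$ is vertical: $\mathbf d=d_3e_3$. With this normalization, any solution of $\mathbf b'(t)=\mathscr R^{\Omega t}\mathbf d$ is $\mathbf b(t)=d_3t\,e_3+\mathbf b_0$ with $\mathbf b_0\in\mathbb R^3$ constant.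
   Context: $e_3=(0,0,1)$; $\mathbb S^2$ is the unit sphere in $\mathbb R^3$; $\mathscr R^{\Omega t}$ is the rotation of angle $\Omega t$ around the $x_3$-axis; primes on $\mathbf x,\mathbf X_0$ are derivatives in the profile variable $\xi$. The vector $\mathbf d$ determines the translational part $\mathbf b$ of the rigidly moving filament $\mathbf X(t,s)=\mathscr R^{\Omega t}\mathbf X_0(s-at)+\mathbf b(t)$ through $\mathbf b'(t)=\mathscr R^{\Omega t}\mathbf d$. *)

theory Defs
  imports "HOL-Analysis.Analysis"
begin

definition smooth :: "(real \<Rightarrow> 'a::real_normed_vector) \<Rightarrow> bool" where
  "smooth f \<longleftrightarrow>
    (\<exists>D :: nat \<Rightarrow> real \<Rightarrow> 'a. D 0 = f \<and>
       (\<forall>n \<xi>. (D n has_vector_derivative D (Suc n) \<xi>) (at \<xi>)))"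

definition e3 :: "real^3" where
  "e3 = vector [0, 0, 1]"

(* counterclockwise rotation by the angle \<theta> about the oriented axis e3 *)
definition rot3 :: "real \<Rightarrow> real^3 \<Rightarrow> real^3" where
  "rot3 \<theta> v = vector [cos \<theta> * v$1 - sin \<theta> * v$2, sin \<theta> * v$1 + cos \<theta> * v$2, v$3]"

definition rigid_profile ::
  "real \<Rightarrow> real \<Rightarrow> (real \<Rightarrow> real^3) \<Rightarrow> (real \<Rightarrow> real^3) \<Rightarrow> real^3 \<Rightarrow> bool" where
  "rigid_profile \<Omega> a x X d \<longleftrightarrow>
    smooth x \<and> range x \<subseteq> sphere 0 1 \<and>
    smooth X \<and> (\<forall>\<xi>. (X has_vector_derivative x \<xi>) (at \<xi>)) \<and>
    (\<forall>\<xi>. cross3 (x \<xi>) (vector_derivative x (at \<xi>)) - \<Omega> *\<^sub>R cross3 e3 (X \<xi>) + a *\<^sub>R x \<xi> = d)"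

end

theory Submission
  imports Defs
begin

text \<open>Translating the profile by \<open>c\<close> changes \<open>d\<close> into \<open>d - \<Omega> e3 \<times> c\<close>. As
  \<open>v \<mapsto> e3 \<times> v\<close> squares to minus the projection onto the horizontal plane, the choice
  \<open>c = - (e3 \<times> d) / \<Omega>\<close> cancels exactly the horizontal part of \<open>d\<close>. A vertical vector is fixed by
  the rotations about \<open>e3\<close>, so the derivative of \<open>b\<close> is then constant.\<close>

lemma smooth_add_const:
  assumes "smooth f"
  shows "smooth (\<lambda>\<xi>. f \<xi> + c)"
proof -
  obtain D where D: "D 0 = f" "\<And>n \<xi>. (D n has_vector_derivative D (Suc n) \<xi>) (at \<xi>)"
    using assms unfolding smooth_def by blast
  \<comment> \<open>Only the zeroth entry of the derivative tower absorbs the constant; every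
    \<open>?E (Suc n)\<close> is still \<open>D (Suc n)\<close>.\<close>
  let ?E = "D(0 := (\<lambda>\<xi>. f \<xi> + c))"
  have "(?E n has_vector_derivative ?E (Suc n) \<xi>) (at \<xi>)" for n \<xi>
    using D(2)[of n \<xi>] D(1) by (cases n) (auto simp: has_vector_derivative_add_const)
  then show ?thesis
    unfolding smooth_def by (intro exI[of _ ?E]) simp
qed

text \<open>A shift leaves \<open>x\<close> and its derivative alone, so only the term linear in
  \<open>X\<close> contributes to the change of \<open>d\<close>.\<close>

lemma rigid_profile_translate:
  assumes "rigid_profile \<Omega> a x X d"
  shows "rigid_profile \<Omega> a x (\<lambda>\<xi>. X \<xi> + c) (d - \<Omega> *\<^sub>R cross3 e3 c)"
  using assms unfolding rigid_profile_def
  by (simp add: smooth_add_const has_vector_derivative_add_const) (simp add: cross_add_right algebra_simps)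

lemma cross_e3_cross_e3: "cross3 e3 (cross3 e3 v) = (v $ 3) *\<^sub>R e3 - v"
  by (simp add: vec_eq_iff forall_3 e3_def cross3_simps)

lemma rot3_vertical: "rot3 \<theta> (r *\<^sub>R e3) = r *\<^sub>R e3"
  by (simp add: vec_eq_iff forall_3 e3_def rot3_def)

lemma constant_velocity:
  fixes b :: "real \<Rightarrow> 'a::real_normed_vector"
  assumes "\<And>t. (b has_vector_derivative v) (at t)"
  shows "b t = t *\<^sub>R v + b 0"
proof -
  \<comment> \<open>Removing the uniform motion leaves a function with zero derivative on the whole
    line, hence a constant.\<close>
  have "((\<lambda>t. b t - t *\<^sub>R v) has_vector_derivative 0) (at t within UNIV)" for t
    using assms by (auto intro!: derivative_eq_intros)
  then obtain k where "\<And>t. b t - t *\<^sub>R v = k"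
    using has_vector_derivative_zero_constant[OF convex_UNIV] by (metis UNIV_I)
  from this[of t] this[of 0] show ?thesis
    by (simp add: algebra_simps)
qed

theorem lemma6p1:
  fixes \<Omega> a :: real and x X\<^sub>0 :: "real \<Rightarrow> real^3" and d :: "real^3"
  assumes "\<Omega> \<noteq> 0"
    and "rigid_profile \<Omega> a x X\<^sub>0 d"
  shows "(\<exists>(c :: real^3) (d\<^sub>3 :: real).
            rigid_profile \<Omega> a x (\<lambda>\<xi>. X\<^sub>0 \<xi> + c) (d\<^sub>3 *\<^sub>R e3)) \<and>
         (\<forall>(c :: real^3) (d\<^sub>3 :: real).
            rigid_profile \<Omega> a x (\<lambda>\<xi>. X\<^sub>0 \<xi> + c) (d\<^sub>3 *\<^sub>R e3) \<longrightarrow>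
            (\<forall>b :: real \<Rightarrow> real^3.
               (\<forall>t. (b has_vector_derivative rot3 (\<Omega> * t) (d\<^sub>3 *\<^sub>R e3)) (at t)) \<longrightarrow>
               (\<exists>b\<^sub>0 :: real^3. \<forall>t. b t = (d\<^sub>3 * t) *\<^sub>R e3 + b\<^sub>0)))"
proof (intro conjI allI impI)
  let ?c = "(- 1 / \<Omega>) *\<^sub>R cross3 e3 d"
  \<comment> \<open>The factor \<open>- 1 / \<Omega>\<close> turns the left side into
    \<open>d\<close> plus the double cross product of \<open>e3\<close> with \<open>d\<close>, so
    the witness for \<open>d\<^sub>3\<close> is \<open>d $ 3\<close>.\<close>
  have "d - \<Omega> *\<^sub>R cross3 e3 ?c = (d $ 3) *\<^sub>R e3"
    using \<open>\<Omega> \<noteq> 0\<close> by (simp add: cross_mult_right cross_e3_cross_e3)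
  then show "\<exists>c d\<^sub>3. rigid_profile \<Omega> a x (\<lambda>\<xi>. X\<^sub>0 \<xi> + c) (d\<^sub>3 *\<^sub>R e3)"
    using rigid_profile_translate[OF assms(2), of ?c] by metis
next
  fix d\<^sub>3 :: real and b :: "real \<Rightarrow> real^3"
  assume "\<forall>t. (b has_vector_derivative rot3 (\<Omega> * t) (d\<^sub>3 *\<^sub>R e3)) (at t)"
  \<comment> \<open>The integration constant \<open>b\<^sub>0\<close> is the initial position
    \<open>b 0\<close>.\<close>
  then have "b t = t *\<^sub>R d\<^sub>3 *\<^sub>R e3 + b 0" for t
    by (intro constant_velocity) (simp add: rot3_vertical)
  then show "\<exists>b\<^sub>0. \<forall>t. b t = (d\<^sub>3 * t) *\<^sub>R e3 + b\<^sub>0"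
    by (metis mult.commute scaleR_scaleR)
qed

end
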